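(* Let $n>3$ and let $f:\Omega\subseteq\mathbb{E}_n\to\mathbb{R}$ be strongly differentiable at a point $\mathbf{x}_0$ internal to $\Omega$. Then $$\lim_{\substack{(\mathbf{a}_1,\dots,\mathbf{a}_{n+1})\to(\mathbf{x}_0,\dots,\mathbf{x}_0)\in\mathbb{E}_n^{n+1}\\ \Delta_{(\mathbf{a}_1,\dots,\mathbf{a}_{n+1})}\neq 0}}\Big(\overline{\Delta}f_{(\mathbf{a}_1,\dots,\mathbf{a}_{n+1})}\Big)\big(\Delta_{(\mathbf{a}_1,\dots,\mathbf{a}_{n+1})}\big)^{-1}=\nabla f(\mathbf{x}_0),$$ where the product and the inverse are those of the Clifford algebra $\mathbb{G}_n$, and the limit is taken over $(n+1)$-tuples of points of $\Omega$ for which the mirrored points $\overline{\mathbf{a}_1},\dots,\overline{\mathbf{a}_{n-1}}$ also lie in $\Omega$ (which is automatic when the $\mathbf{a}_i$ are close enough to $\mathbf{x}_0$).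
   Context: $\mathbb{E}_n$ is the $n$-dimensional real Euclidean vector space with scalar product $\mathbf{u}\cdot\mathbf{v}$; its vectors are also called points. $\mathbb{G}_n=\mathcal{C}\ell(\mathbb{E}_n)$ is the Clifford (geometric) algebra generated by $\mathbb{E}_n$, an associative algebra of dimension $2^n$ with product denoted by juxtaposition and $\mathbf{v}\mathbf{v}=\mathbf{v}\cdot\mathbf{v}$ for every $\mathbf{v}\in\mathbb{E}_n$. For vectors, $\mathbf{u}_1\wedge\cdots\wedge\mathbf{u}_k=\frac1{k!}\sum_{\sigma\in\mathcal{S}_k}\epsilon_\sigma\,\mathbf{u}_{\sigma_1}\cdots\mathbf{u}_{\sigma_k}$, where $\epsilon_\sigma$ is the sign of the permutation $\sigma$. Strong differentiability: $f:\Omega\subseteq\mathbb{E}_n\to\mathbb{R}$ is strongly differentiable at $\mathbf{x}_0$ (a point internal to $\Omega$) if there is a vector $\mathbf{f^*}(\mathbf{x}_0)\in\mathbb{E}_n$ such that for each $\epsilon>0$ there is $\delta>0$ such that for all distinct $\mathbf{u},\mathbf{v}\in\Omega$ with $|\mathbf{u}-\mathbf{x}_0|<\delta$ and $|\mathbf{v}-\mathbf{x}_0|<\delta$ one has $|f(\mathbf{u})-f(\mathbf{v})-\mathbf{f^*}(\mathbf{x}_0)\cdot(\mathbf{u}-\mathbf{v})|<\epsilon|\mathbf{u}-\mathbf{v}|$. In that case $f$ is differentiable at $\mathbf{x}_0$ and $\mathbf{f^*}(\mathbf{x}_0)=\nabla f(\mathbf{x}_0)$. For points $\mathbf{a}_1,\dots,\mathbf{a}_{n+1}\in\mathbb{E}_n$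 define $$\Delta_{(\mathbf{a}_1,\dots,\mathbf{a}_{n+1})}=(\mathbf{a}_2-\mathbf{a}_1)\wedge(\mathbf{a}_3-\mathbf{a}_1)\wedge\cdots\wedge(\mathbf{a}_{n+1}-\mathbf{a}_1).$$ It is non-zero exactly when the points are the vertices of a non degenerate simplex, and it is then invertible in $\mathbb{G}_n$. In that case, for $i=1,\dots,n-1$, let $\overline{\mathbf{a}_i}$ be the mirror image (orthogonal reflection) of $\mathbf{a}_i$ through the affine subspace $\{\nu_{i+1}\mathbf{a}_{i+1}+\cdots+\nu_{n+1}\mathbf{a}_{n+1}:\nu_j\in\mathbb{R},\ \sum_j\nu_j=1\}$ passing through $\mathbf{a}_{i+1},\dots,\mathbf{a}_{n+1}$; that is, $\overline{\mathbf{a}_i}=2P_i(\mathbf{a}_i)-\mathbf{a}_i$ with $P_i$ the orthogonal projection onto that affine subspace. Define $$\overline{\Delta}_{(\mathbf{a}_1,\dots,\mathbf{a}_{n+1})}=(\overline{\mathbf{a}_1}-\mathbf{a}_1)\wedge\cdots\wedge(\overline{\mathbf{a}_{n-1}}-\mathbf{a}_{n-1}),$$ $$\overline{\Delta^i}_{(\mathbf{a}_1,\dots,\mathbf{a}_{n+1})}=\Bigg(\bigwedge_{j=1,\,j\neq i}^{n-1}(\overline{\mathbf{a}_j}-\mathbf{a}_j)\Bigg)\wedge(\mathbf{a}_{n+1}-\mathbf{a}_n),\qquad i=1,\dots,n-1$$ (factors in increasing order of index). The mean multi-difference pseudo-vector is $$\overline{\Delta}f_{(\mathbf{a}_1,\dots,\mathbf{a}_{n+1})}=\frac1{2^{n-1}}\left\{\sum_{i=1}^{n-1}(-1)^{i+1}[f(\overline{\mathbf{a}_i})-f(\mathbf{a}_i)]\,\overline{\Delta^i}_{(\mathbf{a}_1,\dots,\mathbf{a}_{n+1})}+(-1)^{n+1}[f(\mathbf{a}_{n+1})-f(\mathbf{a}_n)]\,\overline{\Delta}_{(\mathbf{a}_1,\dots,\mathbf{a}_{n+1})}\right\}.$$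 *)

theory Defs
  imports "HOL-Analysis.Analysis" "HOL-Combinatorics.Permutations"
begin

section \<open>The Clifford algebra of Euclidean space\<close>

text \<open>
  Multivectors over \<open>real ^ 'n\<close> are given by their coefficients with respect to the blades
  \<open>e_A = e_{i1} \<cdots> e_{ik}\<close>, where \<open>A = {i1, \<dots>, ik}\<close> is a set of indices. The factors are
  arranged in the order given by \<open>to_nat\<close>; this choice only affects the signs of the
  basis blades. A separate type is needed because \<open>real ^ 'n set\<close> already carries the
  componentwise product. The topology is that of the coefficient space.
\<close>

typedef 'n clifford = "UNIV :: (real ^ ('n::finite) set) set"
  morphisms blade_coeffs Clifford ..

setup_lifting type_definition_clifford

lemma clifford_eqI: "(\<And>A. blade_coeffs x $ A = blade_coeffs y $ A) \<Longrightarrow> x = y"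
  by (metis blade_coeffs_inject vec_eq_iff)

text \<open>
  Sign of the permutation that sorts the concatenation of the sorted factors of \<open>e_A\<close> and
  \<open>e_B\<close>, so that \<open>e_A e_B = reorder_sign A B e_C\<close> with \<open>C\<close> the symmetric difference
  (as \<open>e_i e_i = 1\<close>).
\<close>

definition reorder_sign :: "'n::finite set \<Rightarrow> 'n set \<Rightarrow> real" where
  "reorder_sign A B = (\<Prod>i\<in>A. \<Prod>j\<in>B. if to_nat j < to_nat i then - 1 else 1)"

lemma prod_sym_diff:
  fixes g :: "'n::finite \<Rightarrow> real"
  assumes "\<And>i. g i * g i = 1"
  shows "prod g (sym_diff A B) = prod g A * prod g B"
proof -
  have sq: "prod g (A \<inter> B) * prod g (A \<inter> B) = 1"
    by (simp add: prod.distrib [symmetric] assms)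
  have A: "prod g A = prod g (A - B) * prod g (A \<inter> B)"
    by (subst prod.union_disjoint [symmetric]) (auto intro: arg_cong [where f = "prod g"])
  have B: "prod g B = prod g (B - A) * prod g (A \<inter> B)"
    by (subst prod.union_disjoint [symmetric]) (auto intro: arg_cong [where f = "prod g"])
  have "prod g (sym_diff A B) = prod g (A - B) * prod g (B - A)"
    by (subst prod.union_disjoint) auto
  also have "\<dots> = prod g (A - B) * prod g (B - A) * (prod g (A \<inter> B) * prod g (A \<inter> B))"
    by (simp add: sq)
  finally show ?thesis
    by (simp add: A B mult_ac)
qed

lemma reorder_sign_sym_diff_left:
  "reorder_sign (sym_diff A B) C = reorder_sign A C * reorder_sign B C"
  unfolding reorder_sign_def
  by (rule prod_sym_diff) (simp add: prod.distrib [symmetric] if_distrib cong: if_cong)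

lemma reorder_sign_sym_diff_right:
  "reorder_sign A (sym_diff B C) = reorder_sign A B * reorder_sign A C"
  unfolding reorder_sign_def prod.distrib [symmetric]
  by (intro prod.cong refl prod_sym_diff) simp

lemma reorder_sign_empty [simp]: "reorder_sign {} B = 1" "reorder_sign A {} = 1"
  by (simp_all add: reorder_sign_def)

lemma sym_diff_simps:
  "sym_diff A (sym_diff A B) = B" "sym_diff (sym_diff A C) (sym_diff A D) = sym_diff C D"
  "sym_diff A B = sym_diff B A"
  by auto

lemma bij_sym_diff: "bij (\<lambda>B. sym_diff A B)"
  by (rule involuntory_imp_bij) (fact sym_diff_simps(1))

lemma sum_sym_diff_reindex: "(\<Sum>B\<in>UNIV. f (sym_diff A B)) = (\<Sum>B\<in>UNIV. f B)"
  using sum.reindex_bij_betw [OF bij_sym_diff] .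

instantiation clifford :: (finite) real_vector
begin

lift_definition zero_clifford :: "'a clifford" is 0 .
lift_definition plus_clifford :: "'a clifford \<Rightarrow> 'a clifford \<Rightarrow> 'a clifford" is "(+)" .
lift_definition minus_clifford :: "'a clifford \<Rightarrow> 'a clifford \<Rightarrow> 'a clifford" is "(-)" .
lift_definition uminus_clifford :: "'a clifford \<Rightarrow> 'a clifford" is uminus .
lift_definition scaleR_clifford :: "real \<Rightarrow> 'a clifford \<Rightarrow> 'a clifford" is scaleR .

instance
  by standard (transfer; simp add: algebra_simps)+

end

instantiation clifford :: (finite) real_normed_vector
begin

lift_definition norm_clifford :: "'a clifford \<Rightarrow> real" is norm .
lift_definition dist_clifford :: "'a clifford \<Rightarrow> 'a clifford \<Rightarrow> real" is dist .
lift_definition sgn_clifford :: "'a clifford \<Rightarrow> 'a clifford" is sgn .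

definition uniformity_clifford :: "('a clifford \<times> 'a clifford) filter" where
  "uniformity_clifford = (INF e\<in>{0<..}. principal {(x, y). dist x y < e})"

definition open_clifford :: "'a clifford set \<Rightarrow> bool" where
  "open_clifford U \<longleftrightarrow> (\<forall>x\<in>U. eventually (\<lambda>(x', y). x' = x \<longrightarrow> y \<in> U) uniformity)"

instance
proof
  fix a :: real and x y :: "'a clifford"
  show "sgn x = x /\<^sub>R norm x" by transfer (simp add: sgn_div_norm)
  show "dist x y = norm (x - y)" by transfer (simp add: dist_norm)
  show "norm x = 0 \<longleftrightarrow> x = 0" by transfer simp
  show "norm (x + y) \<le> norm x + norm y" by transfer (rule norm_triangle_ineq)
  show "norm (a *\<^sub>R x) = \<bar>a\<bar> * norm x" by transfer simp
qed (simp_all add: uniformity_clifford_def open_clifford_def)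

end

instantiation clifford :: (finite) real_algebra_1
begin

lift_definition one_clifford :: "'a clifford" is "axis {} 1" .

lift_definition times_clifford :: "'a clifford \<Rightarrow> 'a clifford \<Rightarrow> 'a clifford" is
  "\<lambda>x y. \<chi> C. \<Sum>A\<in>UNIV. reorder_sign A (sym_diff A C) * (x $ A) * (y $ sym_diff A C)" .

instance
proof
  fix r :: real and x y z :: "'a clifford"
  have sgn: "reorder_sign C (sym_diff C D) * reorder_sign A (sym_diff A C) =
      reorder_sign A (sym_diff A D) * reorder_sign (sym_diff A C) (sym_diff C D)" for A C D :: "'a set"
  proof -
    have "reorder_sign C (sym_diff C D) = reorder_sign (sym_diff A (sym_diff A C)) (sym_diff C D)"
      by (simp only: sym_diff_simps(1))
    moreover have "sym_diff A D = sym_diff (sym_diff A C) (sym_diff C D)" by auto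
    ultimately show ?thesis
      by (simp only: reorder_sign_sym_diff_left [of A "sym_diff A C"]
          reorder_sign_sym_diff_right [of A "sym_diff A C"] mult_ac)
  qed
  show "x * y * z = x * (y * z)"
  proof (rule clifford_eqI)
    fix D
    let ?x = "\<lambda>A. blade_coeffs x $ A" and ?y = "\<lambda>A. blade_coeffs y $ A" and ?z = "\<lambda>A. blade_coeffs z $ A"
    have "blade_coeffs (x * y * z) $ D = (\<Sum>C\<in>UNIV. \<Sum>A\<in>UNIV.
        reorder_sign C (sym_diff C D) * reorder_sign A (sym_diff A C) *
        (?x A * ?y (sym_diff A C) * ?z (sym_diff C D)))"
      by (simp add: times_clifford.rep_eq sum_distrib_left sum_distrib_right mult_ac)
    also have "\<dots> = (\<Sum>A\<in>UNIV. \<Sum>C\<in>UNIV.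
        reorder_sign A (sym_diff A D) * reorder_sign (sym_diff A C) (sym_diff C D) *
        (?x A * ?y (sym_diff A C) * ?z (sym_diff C D)))"
      by (subst sum.swap) (simp only: sgn)
    also have "\<dots> = (\<Sum>A\<in>UNIV. \<Sum>C\<in>UNIV.
        reorder_sign A (sym_diff A D) *
        reorder_sign (sym_diff A C) (sym_diff (sym_diff A C) (sym_diff A D)) *
        (?x A * ?y (sym_diff A C) * ?z (sym_diff (sym_diff A C) (sym_diff A D))))"
      by (simp only: sym_diff_simps(2))
    also have "\<dots> = (\<Sum>A\<in>UNIV. \<Sum>B\<in>UNIV.
        reorder_sign A (sym_diff A D) * reorder_sign B (sym_diff B (sym_diff A D)) *
        (?x A * ?y B * ?z (sym_diff B (sym_diff A D))))"
      by (rule sum.cong [OF refl], rule sum_sym_diff_reindex [where f = "\<lambda>B.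
        reorder_sign _ (sym_diff _ D) * reorder_sign B (sym_diff B (sym_diff _ D)) *
        (?x _ * ?y B * ?z (sym_diff B (sym_diff _ D)))"])
    also have "\<dots> = blade_coeffs (x * (y * z)) $ D"
      by (simp add: times_clifford.rep_eq sum_distrib_left mult_ac)
    finally show "blade_coeffs (x * y * z) $ D = blade_coeffs (x * (y * z)) $ D" .
  qed
  show "(x + y) * z = x * z + y * z"
    by (rule clifford_eqI)
      (simp add: times_clifford.rep_eq plus_clifford.rep_eq algebra_simps sum.distrib)
  show "x * (y + z) = x * y + x * z"
    by (rule clifford_eqI)
      (simp add: times_clifford.rep_eq plus_clifford.rep_eq algebra_simps sum.distrib)
  show "r *\<^sub>R x * y = r *\<^sub>R (x * y)"
    by (rule clifford_eqI)
      (simp add: times_clifford.rep_eq scaleR_clifford.rep_eq sum_distrib_left mult_ac)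
  show "x * r *\<^sub>R y = r *\<^sub>R (x * y)"
    by (rule clifford_eqI)
      (simp add: times_clifford.rep_eq scaleR_clifford.rep_eq sum_distrib_left mult_ac)
  show "1 * x = x"
  proof (rule clifford_eqI)
    fix C
    have "blade_coeffs (1 * x) $ C = (\<Sum>A\<in>(UNIV :: 'a set set). if A = {} then blade_coeffs x $ C else 0)"
      unfolding times_clifford.rep_eq one_clifford.rep_eq vec_lambda_beta
      by (rule sum.cong) (auto simp: axis_def)
    then show "blade_coeffs (1 * x) $ C = blade_coeffs x $ C" by simp
  qed
  show "x * 1 = x"
  proof (rule clifford_eqI)
    fix C
    have eq: "sym_diff A C = {} \<longleftrightarrow> A = C" for A :: "'a set" by auto
    have "blade_coeffs (x * 1) $ C = (\<Sum>A\<in>UNIV. if A = C then blade_coeffs x $ C else 0)"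
      unfolding times_clifford.rep_eq one_clifford.rep_eq vec_lambda_beta
      by (rule sum.cong) (auto simp: axis_def eq)
    then show "blade_coeffs (x * 1) $ C = blade_coeffs x $ C" by simp
  qed
  have "blade_coeffs (0 :: 'a clifford) $ {} \<noteq> blade_coeffs (1 :: 'a clifford) $ {}"
    by (simp add: zero_clifford.rep_eq one_clifford.rep_eq axis_def)
  then show "(0 :: 'a clifford) \<noteq> 1" by metis
qed

end

definition blade :: "'n::finite set \<Rightarrow> 'n clifford" where
  "blade A = Clifford (axis A 1)"

text \<open>The embedding of Euclidean space.\<close>

definition cvec :: "real ^ 'n::finite \<Rightarrow> 'n clifford" where
  "cvec v = (\<Sum>i\<in>UNIV. (v $ i) *\<^sub>R blade {i})"

text \<open>
  The next facts show that this is indeed the Clifford algebra of Euclidean space: a real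
  algebra of dimension \<open>2 ^ n\<close>, generated by the vectors, in which \<open>v v = v \<bullet> v\<close>.
\<close>

lemma blade_coeffs_blade: "blade_coeffs (blade A) $ B = (if B = A then 1 else 0)"
  by (simp add: blade_def Clifford_inverse axis_def)

lemma blade_coeffs_sum: "blade_coeffs (\<Sum>i\<in>I. f i) = (\<Sum>i\<in>I. blade_coeffs (f i))"
  by (induction I rule: infinite_finite_induct)
    (auto simp: zero_clifford.rep_eq plus_clifford.rep_eq)

lemma blade_empty: "blade {} = 1"
  by (rule clifford_eqI) (simp add: blade_coeffs_blade one_clifford.rep_eq axis_def)

lemma blade_mult: "blade A * blade B = reorder_sign A B *\<^sub>R blade (sym_diff A B)"
proof (rule clifford_eqI)
  fix C
  have eq: "sym_diff A C = B \<longleftrightarrow> C = sym_diff A B" by blast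
  have "blade_coeffs (blade A * blade B) $ C =
      (\<Sum>A'\<in>UNIV. if A' = A then if C = sym_diff A B then reorder_sign A B else 0 else 0)"
    unfolding times_clifford.rep_eq vec_lambda_beta
    by (rule sum.cong) (use eq in \<open>auto simp: blade_coeffs_blade\<close>)
  then show "blade_coeffs (blade A * blade B) $ C =
      blade_coeffs (reorder_sign A B *\<^sub>R blade (sym_diff A B)) $ C"
    by (simp add: scaleR_clifford.rep_eq blade_coeffs_blade)
qed

lemma clifford_expansion: "x = (\<Sum>A\<in>UNIV. (blade_coeffs x $ A) *\<^sub>R blade A)"
  by (rule clifford_eqI)
    (simp add: blade_coeffs_sum scaleR_clifford.rep_eq blade_coeffs_blade if_distrib cong: if_cong)

lemma blade_insert_least:
  assumes "\<And>j. j \<in> A \<Longrightarrow> to_nat i < to_nat j"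
  shows "blade {i} * blade A = blade (insert i A)"
proof -
  have "i \<notin> A" using assms by blast
  then have "sym_diff {i} A = insert i A" by auto
  moreover have "reorder_sign {i} A = 1"
    unfolding reorder_sign_def using assms by (fastforce intro!: prod.neutral)
  ultimately show ?thesis by (simp add: blade_mult)
qed

lemma blade_singleton_square: "blade {i} * blade {i} = 1"
  by (simp add: blade_mult reorder_sign_def blade_empty)

lemma blade_singleton_anticommute:
  assumes "i \<noteq> j"
  shows "blade {i} * blade {j} = - (blade {j} * blade {i})"
proof -
  have "reorder_sign {i} {j} = - reorder_sign {j} {i}"
    using assms by (auto simp: reorder_sign_def dest: linorder_neqE_nat)
  moreover have "sym_diff {i} {j} = sym_diff {j} {i}" by auto
  ultimately show ?thesis by (simp add: blade_mult)
qed

lemma linear_cvec: "linear cvec"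
  by (rule linearI)
    (simp_all add: cvec_def scaleR_add_left sum.distrib scaleR_sum_right)

lemma cvec_axis: "cvec (axis i 1) = blade {i}"
  by (simp add: cvec_def axis_def if_distrib [where f = "\<lambda>r. r *\<^sub>R _"] cong: if_cong)

lemma cvec_square: "cvec v * cvec v = of_real (v \<bullet> v)"
proof -
  let ?f = "\<lambda>i j. (v $ i * v $ j) *\<^sub>R (blade {i} * blade {j})"
  have anti: "?f i j + ?f j i = (if i = j then (2 * (v $ i * v $ i)) *\<^sub>R 1 else 0)" for i j
  proof (cases "i = j")
    case True
    then show ?thesis
      by (simp add: blade_singleton_square scaleR_add_left [symmetric])
  next
    case False
    then show ?thesis
      using blade_singleton_anticommute [OF False] by (simp add: mult.commute)
  qed
  have eq: "cvec v * cvec v = (\<Sum>i\<in>UNIV. \<Sum>j\<in>UNIV. ?f i j)"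
    unfolding cvec_def sum_product by (simp add: mult.commute)
  have eq': "cvec v * cvec v = (\<Sum>i\<in>UNIV. \<Sum>j\<in>UNIV. ?f j i)"
    unfolding eq by (rule sum.swap)
  have "2 *\<^sub>R (cvec v * cvec v) = cvec v * cvec v + cvec v * cvec v"
    by (simp add: scaleR_2)
  also have "\<dots> = (\<Sum>i\<in>UNIV. \<Sum>j\<in>UNIV. ?f i j) + (\<Sum>i\<in>UNIV. \<Sum>j\<in>UNIV. ?f j i)"
    by (metis eq eq')
  also have "\<dots> = (\<Sum>i\<in>UNIV. \<Sum>j\<in>UNIV. ?f i j + ?f j i)"
    by (simp only: sum.distrib)
  also have "\<dots> = (\<Sum>i\<in>UNIV. (2 * (v $ i * v $ i)) *\<^sub>R 1)"
    by (simp only: anti) simp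
  also have "\<dots> = 2 *\<^sub>R of_real (v \<bullet> v)"
    by (simp add: inner_vec_def of_real_def scaleR_sum_left scaleR_sum_right)
  finally show ?thesis by simp
qed

lemma clifford_generated:
  assumes "1 \<in> S" and "range cvec \<subseteq> S"
    and "\<And>x y. x \<in> S \<Longrightarrow> y \<in> S \<Longrightarrow> x + y \<in> S"
    and "\<And>x y. x \<in> S \<Longrightarrow> y \<in> S \<Longrightarrow> x * y \<in> S"
    and "\<And>r x. x \<in> S \<Longrightarrow> r *\<^sub>R x \<in> S"
  shows "S = UNIV"
proof -
  have blade: "blade A \<in> S" for A
  proof (induction "card A" arbitrary: A)
    case 0
    then show ?case by (simp add: blade_empty assms(1))
  next
    case (Suc k)
    then have "A \<noteq> {}" by auto
    then obtain i where i: "i \<in> A" "\<And>j. j \<in> A \<Longrightarrow> to_nat i \<le> to_nat j"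
      using ex_has_least_nat [of "\<lambda>i. i \<in> A" _ to_nat] by blast
    have "blade {i} \<in> S" using assms(2) cvec_axis [of i] by (metis range_subsetD)
    moreover have "blade (A - {i}) \<in> S" using Suc i by simp
    moreover have "to_nat i < to_nat j" if "j \<in> A - {i}" for j
      using i(2) [of j] that by (simp add: order.strict_iff_order) auto
    ultimately show ?case
      using blade_insert_least [of "A - {i}" i] i(1) assms(4) by (metis insert_Diff)
  qed
  have zero: "0 \<in> S" using assms(5) [OF assms(1), of 0] by simp
  have "(\<Sum>A\<in>I. r A *\<^sub>R blade A) \<in> S" for I r
    by (induction I rule: infinite_finite_induct) (auto intro: zero assms(3,5) blade)
  then show ?thesis by (metis UNIV_eq_I clifford_expansion)
qed

lemma dim_clifford: "dim (UNIV :: 'n::finite clifford set) = 2 ^ CARD('n)"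
proof -
  have inj: "inj (blade :: 'n set \<Rightarrow> _)"
    by (rule injI) (metis blade_coeffs_blade zero_neq_one)
  have "independent (range (blade :: 'n set \<Rightarrow> _))"
  proof (rule independent_if_scalars_zero)
    fix f :: "'n clifford \<Rightarrow> real" and x :: "'n clifford"
    assume *: "(\<Sum>y\<in>range blade. f y *\<^sub>R y) = 0" and "x \<in> range blade"
    then obtain A where x: "x = blade A" by blast
    have "(\<Sum>B\<in>UNIV. f (blade B) *\<^sub>R blade B) = 0"
      using * by (simp add: sum.reindex inj)
    then have "blade_coeffs (\<Sum>B\<in>UNIV. f (blade B) *\<^sub>R blade B) $ A = 0"
      by (simp add: zero_clifford.rep_eq)
    then show "f x = 0"
      by (simp add: x blade_coeffs_sum scaleR_clifford.rep_eq blade_coeffs_blade if_distrib cong: if_cong)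
  qed simp
  moreover have "x \<in> span (range blade)" for x :: "'n clifford"
    by (subst clifford_expansion) (intro span_sum span_scale span_base rangeI)
  ultimately have "dim (UNIV :: 'n clifford set) = card (range (blade :: 'n set \<Rightarrow> _))"
    by (intro dim_unique) auto
  moreover have "CARD('n set) = 2 ^ CARD('n)"
    using card_Pow [of "UNIV :: 'n set"] by simp
  ultimately show ?thesis by (simp add: card_image inj)
qed

definition clifford_inverse :: "'n::finite clifford \<Rightarrow> 'n clifford" where
  "clifford_inverse x = (THE y. x * y = 1 \<and> y * x = 1)"

lemma clifford_inverse_eqI:
  assumes "x * y = 1" "y * x = 1"
  shows "clifford_inverse x = y"
  unfolding clifford_inverse_def
proof (rule the_equality)
  fix z
  assume "x * z = 1 \<and> z * x = 1"
  then show "z = y" using assms by (metis mult.assoc mult_1_left mult_1_right)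
qed (use assms in blast)

definition wedge :: "(real ^ 'n::finite) list \<Rightarrow> 'n clifford" where
  "wedge us = (1 / fact (length us)) *\<^sub>R
     (\<Sum>\<sigma> | \<sigma> permutes {..<length us}.
        of_int (sign \<sigma>) *\<^sub>R prod_list (map (\<lambda>k. cvec (us ! \<sigma> k)) [0..<length us]))"


section \<open>Strong differentiability and the gradient\<close>

definition has_strong_gradient ::
    "(real ^ 'n::finite \<Rightarrow> real) \<Rightarrow> (real ^ 'n) set \<Rightarrow> real ^ 'n \<Rightarrow> real ^ 'n \<Rightarrow> bool" where
  "has_strong_gradient f \<Omega> x\<^sub>0 g \<longleftrightarrow>
     (\<forall>\<epsilon>>0. \<exists>\<delta>>0. \<forall>u\<in>\<Omega>. \<forall>v\<in>\<Omega>.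
        u \<noteq> v \<and> norm (u - x\<^sub>0) < \<delta> \<and> norm (v - x\<^sub>0) < \<delta> \<longrightarrow>
        \<bar>f u - f v - g \<bullet> (u - v)\<bar> < \<epsilon> * norm (u - v))"

definition strongly_differentiable ::
    "(real ^ 'n::finite \<Rightarrow> real) \<Rightarrow> (real ^ 'n) set \<Rightarrow> real ^ 'n \<Rightarrow> bool" where
  "strongly_differentiable f \<Omega> x\<^sub>0 \<longleftrightarrow> (\<exists>g. has_strong_gradient f \<Omega> x\<^sub>0 g)"

definition gradient :: "(real ^ 'n::finite \<Rightarrow> real) \<Rightarrow> real ^ 'n \<Rightarrow> real ^ 'n" where
  "gradient f x = (THE g. GDERIV f x :> g)"

lemma gradient_eqI:
  assumes "GDERIV f x :> g"
  shows "gradient f x = g"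
  unfolding gradient_def
proof (rule the_equality)
  fix h
  assume "GDERIV f x :> h"
  then have "(\<lambda>u. u \<bullet> h) = (\<lambda>u. u \<bullet> g)"
    using assms unfolding gderiv_def by (rule has_derivative_unique)
  then show "h = g" by (simp add: fun_eq_iff vector_eq_ldot)
qed (fact assms)

lemma has_strong_gradient_imp_gradient:
  assumes "x\<^sub>0 \<in> interior \<Omega>" and "has_strong_gradient f \<Omega> x\<^sub>0 g"
  shows "GDERIV f x\<^sub>0 :> g" and "gradient f x\<^sub>0 = g"
proof -
  show *: "GDERIV f x\<^sub>0 :> g"
    unfolding gderiv_def has_derivative_at_alt
  proof (intro conjI allI impI)
    show "bounded_linear (\<lambda>h. h \<bullet> g)" by (rule bounded_linear_inner_left)
    fix e :: real
    assume "0 < e"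
    obtain r where r: "r > 0" "ball x\<^sub>0 r \<subseteq> \<Omega>"
      using assms(1) by (auto simp: mem_interior)
    obtain d where d: "d > 0" "\<And>u v. u \<in> \<Omega> \<Longrightarrow> v \<in> \<Omega> \<Longrightarrow>
        u \<noteq> v \<and> norm (u - x\<^sub>0) < d \<and> norm (v - x\<^sub>0) < d \<Longrightarrow>
        \<bar>f u - f v - g \<bullet> (u - v)\<bar> < e * norm (u - v)"
      using assms(2) \<open>0 < e\<close> unfolding has_strong_gradient_def by meson
    have "norm (f y - f x\<^sub>0 - (y - x\<^sub>0) \<bullet> g) \<le> e * norm (y - x\<^sub>0)"
      if "norm (y - x\<^sub>0) < min d r" for y
    proof (cases "y = x\<^sub>0")
      case False
      have "y \<in> \<Omega>" "x\<^sub>0 \<in> \<Omega>"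
        using r that by (auto simp: subset_iff dist_norm norm_minus_commute)
      then show ?thesis
        using d(2) [of y x\<^sub>0] that False d(1) by (simp add: inner_commute)
    qed simp
    then show "\<exists>d>0. \<forall>y. norm (y - x\<^sub>0) < d \<longrightarrow>
        norm (f y - f x\<^sub>0 - (y - x\<^sub>0) \<bullet> g) \<le> e * norm (y - x\<^sub>0)"
      using d(1) r(1) by (intro exI [of _ "min d r"]) auto
  qed
  then show "gradient f x\<^sub>0 = g" by (rule gradient_eqI)
qed


section \<open>Mirror images and the mean multi-difference\<close>

definition affine_proj :: "'a::euclidean_space set \<Rightarrow> 'a \<Rightarrow> 'a" where
  "affine_proj S x = (THE p. p \<in> S \<and> (\<forall>q\<in>S. orthogonal (x - p) (q - p)))"

lemma affine_proj_unique:
  assumes "p \<in> S" "\<forall>q\<in>S. orthogonal (x - p) (q - p)"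
  shows "affine_proj S x = p"
  unfolding affine_proj_def
proof (rule the_equality)
  fix p'
  assume p': "p' \<in> S \<and> (\<forall>q\<in>S. orthogonal (x - p') (q - p'))"
  have "(x - p) \<bullet> (p' - p) = 0" "(x - p') \<bullet> (p - p') = 0"
    using assms p' by (auto simp: orthogonal_def)
  moreover have "(p' - p) \<bullet> (p' - p) = (x - p) \<bullet> (p' - p) + (x - p') \<bullet> (p - p')"
    by (simp add: inner_diff_left inner_diff_right)
  ultimately have "(p' - p) \<bullet> (p' - p) = 0" by simp
  then show "p' = p" by simp
qed (use assms in blast)

lemma affine_proj_works:
  fixes S :: "'a::euclidean_space set"
  assumes "affine S" "S \<noteq> {}"
  shows "affine_proj S x \<in> S"
    "\<And>q. q \<in> S \<Longrightarrow> orthogonal (x - affine_proj S x) (q - affine_proj S x)"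
proof -
  let ?p = "closest_point S x"
  have cl: "closed S" and cv: "convex S"
    using assms by (simp_all add: affine_closed affine_imp_convex)
  have p: "?p \<in> S" using closest_point_in_set [OF cl assms(2)] .
  have orth: "orthogonal (x - ?p) (q - ?p)" if q: "q \<in> S" for q
  proof -
    have le: "(x - ?p) \<bullet> (q - ?p) \<le> 0" using closest_point_dot [OF cv cl q] .
    have "2 *\<^sub>R ?p + (-1) *\<^sub>R q \<in> S"
      using mem_affine [OF assms(1) p q, of 2 "-1"] by simp
    then have "(x - ?p) \<bullet> (2 *\<^sub>R ?p + (-1) *\<^sub>R q - ?p) \<le> 0"
      using closest_point_dot [OF cv cl] by blast
    moreover have "2 *\<^sub>R ?p + (-1) *\<^sub>R q - ?p = - (q - ?p)" by (simp add: scaleR_2)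
    ultimately have "- ((x - ?p) \<bullet> (q - ?p)) \<le> 0" by (metis inner_minus_right)
    with le show ?thesis by (simp add: orthogonal_def)
  qed
  have eq: "affine_proj S x = ?p" using p orth by (intro affine_proj_unique) auto
  show "affine_proj S x \<in> S" using p by (simp add: eq)
  show "orthogonal (x - affine_proj S x) (q - affine_proj S x)" if "q \<in> S" for q
    using orth [OF that] by (simp add: eq)
qed

text \<open>
  With \<open>n = CARD('n)\<close>, tuples of \<open>n + 1\<close> points are functions \<open>a\<close> on \<open>{1..n + 1}\<close>. Their
  space is \<open>{1..n + 1} \<rightarrow>\<^sub>E UNIV\<close>, whose topology as a subspace of \<open>nat \<Rightarrow> real ^ 'n\<close> is the
  product topology, since the values outside the index set are fixed.
\<close>

definition simplex_Delta :: "(nat \<Rightarrow> real ^ 'n::finite) \<Rightarrow> 'n clifford" where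
  "simplex_Delta a = wedge (map (\<lambda>i. a i - a 1) [2..<CARD('n) + 2])"

definition mirror :: "(nat \<Rightarrow> real ^ 'n::finite) \<Rightarrow> nat \<Rightarrow> real ^ 'n" where
  "mirror a i = 2 *\<^sub>R affine_proj (affine hull (a ` {i + 1..CARD('n) + 1})) (a i) - a i"

definition mirror_Delta :: "(nat \<Rightarrow> real ^ 'n::finite) \<Rightarrow> 'n clifford" where
  "mirror_Delta a = wedge (map (\<lambda>j. mirror a j - a j) [1..<CARD('n)])"

definition mirror_Delta_omit :: "(nat \<Rightarrow> real ^ 'n::finite) \<Rightarrow> nat \<Rightarrow> 'n clifford" where
  "mirror_Delta_omit a i =
     wedge (map (\<lambda>j. mirror a j - a j) (filter (\<lambda>j. j \<noteq> i) [1..<CARD('n)]) @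
            [a (CARD('n) + 1) - a CARD('n)])"

definition mean_multi_difference ::
    "(real ^ 'n::finite \<Rightarrow> real) \<Rightarrow> (nat \<Rightarrow> real ^ 'n) \<Rightarrow> 'n clifford" where
  "mean_multi_difference f a = (1 / 2 ^ (CARD('n) - 1)) *\<^sub>R
     ((\<Sum>i = 1..CARD('n) - 1.
         ((- 1) ^ (i + 1) * (f (mirror a i) - f (a i))) *\<^sub>R mirror_Delta_omit a i) +
      ((- 1) ^ (CARD('n) + 1) * (f (a (CARD('n) + 1)) - f (a CARD('n)))) *\<^sub>R mirror_Delta a)"

end

theory Submission
  imports Defs
begin

text \<open>
  Write \<open>n = CARD('n)\<close>. The legs \<open>d_i = mirror a i - a i\<close> for \<open>i < n\<close>, together with
  \<open>d_n = a (n + 1) - a n\<close>, are pairwise orthogonal: reflecting \<open>a i\<close> through the face \<open>S_i\<close>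
  spanned by the later vertices moves it perpendicularly to \<open>S_i\<close>, whereas every later leg
  is parallel to \<open>S_i\<close> (\<open>leg_orthogonal\<close>). A wedge of orthogonal vectors is their Clifford
  product (\<open>wedge_orthogonal\<close>), so all wedges of legs are plain products.

  The legs arise from the edge vectors \<open>a (i + 1) - a 1\<close> by a Gram-Schmidt process that starts
  from the last vertex. It is a triangular change of vectors whose diagonal entries are
  \<open>2, \<dots>, 2, 1\<close>, as a mirror image lies twice as far away as the foot of the perpendicular.
  Hence \<open>d_1 \<cdots> d_n = 2 ^ (n - 1) \<Delta>\<close> (\<open>wedge_legs\<close>), which explains the factor in the
  definition of the mean multi-difference.

  Moving \<open>d_i\<close> through the product and using \<open>d_i d_i = |d_i|\<^sup>2\<close> shows that the product without
  its \<open>i\<close>-th factor is \<open>\<plusminus> (d_i / |d_i|\<^sup>2) (d_1 \<cdots> d_n)\<close>, with exactly the sign that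
  the definition of the mean multi-difference compensates. So the quotient is
  the vector \<open>\<Sum>i. (\<delta>_i f / |d_i|\<^sup>2) d_i\<close>, where \<open>\<delta>_i f\<close> is the increment of \<open>f\<close> along \<open>d_i\<close>
  (\<open>mean_multi_difference_quotient\<close>).

  If \<open>f\<close> has strong gradient \<open>g\<close>, then \<open>\<delta>_i f = g \<bullet> d_i + o(|d_i|)\<close>. The main
  part sums up to the expansion of \<open>g\<close> in the orthogonal basis of the legs, and each of the \<open>n\<close>
  remainders contributes only \<open>o(1)\<close>, however flat the simplex is (\<open>orthogonal_quotients_near\<close>).
  Strong differentiability is what makes this uniform over increments that do not start
  at \<open>x\<^sub>0\<close>; it applies because reflections are isometries and therefore the mirror images
  tend to \<open>x\<^sub>0\<close> as well (\<open>tip_near\<close>).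
\<close>


section \<open>The outer product as an alternating multilinear map\<close>

text \<open>
  A word in which the letter \<open>i\<close> occurs exactly once depends linearly on that letter; the terms
  of a wedge are such words.
\<close>

lemma linear_wedge_term:
  fixes us :: "(real ^ 'n) list"
  assumes "distinct ks" and "i \<in> set ks" and "i < length us"
  shows "linear (\<lambda>x. prod_list (map (\<lambda>k. cvec (us[i := x] ! k)) ks))"
proof -
  obtain as bs where ks: "ks = as @ i # bs"
    using assms(2) split_list by metis
  define A where "A = prod_list (map (\<lambda>k. cvec (us ! k)) as)"
  define B where "B = prod_list (map (\<lambda>k. cvec (us ! k)) bs)"
  have "prod_list (map (\<lambda>k. cvec (us[i := x] ! k)) ks) = A * (cvec x * B)" for x
  proof -
    have "map (\<lambda>k. cvec (us[i := x] ! k)) as = map (\<lambda>k. cvec (us ! k)) as"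
      "map (\<lambda>k. cvec (us[i := x] ! k)) bs = map (\<lambda>k. cvec (us ! k)) bs"
      using assms(1,3) by (auto simp: ks nth_list_update)
    then show ?thesis
      using assms(3) by (simp only: A_def B_def ks map_append list.map prod_list.append
          prod_list.Cons nth_list_update_eq)
  qed
  moreover have "linear (\<lambda>x. A * (cvec x * B))"
    by (rule linearI)
      (simp_all add: linear_add [OF linear_cvec] linear_scale [OF linear_cvec] algebra_simps)
  ultimately show ?thesis by simp
qed

lemma linear_wedge:
  fixes us :: "(real ^ 'n) list"
  assumes "i < length us"
  shows "linear (\<lambda>x. wedge (us[i := x]))"
proof -
  have "linear (\<lambda>x. of_int (sign \<sigma>) *\<^sub>R
      prod_list (map (\<lambda>k. cvec (us[i := x] ! \<sigma> k)) [0..<length us]))"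
    if "\<sigma> permutes {..<length us}" for \<sigma>
  proof (rule linear_compose_scale_right)
    have "linear (\<lambda>x. prod_list (map (\<lambda>k. cvec (us[i := x] ! k)) (map \<sigma> [0..<length us])))"
    proof (rule linear_wedge_term [OF _ _ assms])
      show "distinct (map \<sigma> [0..<length us])"
        using permutes_inj_on [OF that] by (simp add: distinct_map)
      show "i \<in> set (map \<sigma> [0..<length us])"
        using permutes_image [OF that] assms by (simp add: lessThan_atLeast0)
    qed
    then show "linear (\<lambda>x. prod_list (map (\<lambda>k. cvec (us[i := x] ! \<sigma> k)) [0..<length us]))"
      by (simp add: comp_def)
  qed
  then show ?thesis
    unfolding wedge_def length_list_update
    by (intro linear_compose_scale_right linear_compose_sum) auto
qed

text \<open>
  Composing every permutation with the transposition of two equal entries leaves the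
  products unchanged and flips all signs, so the sum equals its own negative.
\<close>

lemma wedge_eq_zero:
  fixes us :: "(real ^ 'n) list"
  assumes "\<not> distinct us"
  shows "wedge us = 0"
proof -
  obtain i j where ij: "i < length us" "j < length us" "i \<noteq> j" "us ! i = us ! j"
    using assms by (auto simp: distinct_conv_nth)
  let ?t = "Transposition.transpose i j"
  define F where "F \<sigma> = of_int (sign \<sigma>) *\<^sub>R
    prod_list (map (\<lambda>k. cvec (us ! \<sigma> k)) [0..<length us])" for \<sigma>
  have t: "?t permutes {..<length us}"
    using ij by (intro permutes_swap_id) auto
  have flip: "F (?t \<circ> \<sigma>) = - F \<sigma>" if "\<sigma> permutes {..<length us}" for \<sigma>
  proof -
    have "permutation \<sigma>" using that permutation_permutes by blast
    then have "sign (?t \<circ> \<sigma>) = - sign \<sigma>"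
      using ij(3) by (simp add: sign_compose permutation_swap_id sign_swap_id)
    moreover have "us ! ?t k = us ! k" for k
      using ij(4) by (simp add: Transposition.transpose_def)
    ultimately show ?thesis by (simp add: F_def)
  qed
  have "(\<Sum>\<sigma> | \<sigma> permutes {..<length us}. F \<sigma>) = (\<Sum>\<sigma> | \<sigma> permutes {..<length us}. F (?t \<circ> \<sigma>))"
    by (rule setum_permutations_compose_left [OF t])
  also have "\<dots> = - (\<Sum>\<sigma> | \<sigma> permutes {..<length us}. F \<sigma>)"
    by (simp add: flip sum_negf)
  finally have "2 *\<^sub>R (\<Sum>\<sigma> | \<sigma> permutes {..<length us}. F \<sigma>) = 0"
    by (simp add: scaleR_2 eq_neg_iff_add_eq_0)
  then show ?thesis by (simp add: wedge_def F_def)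
qed

lemma wedge_update_span:
  fixes us :: "(real ^ 'n) list"
  assumes "i < length us" and "x - c *\<^sub>R y \<in> span (set (take i us) \<union> set (drop (Suc i) us))"
  shows "wedge (us[i := x]) = c *\<^sub>R wedge (us[i := y])"
proof -
  let ?w = "\<lambda>x. wedge (us[i := x])"
  have lin: "linear ?w" using assms(1) by (rule linear_wedge)
  have "?w z = 0" if "z \<in> set (take i us) \<union> set (drop (Suc i) us)" for z
    by (rule wedge_eq_zero) (use that in \<open>auto simp: upd_conv_take_nth_drop [OF assms(1)]\<close>)
  then have "?w (x - c *\<^sub>R y) = 0"
    using linear_eq_0_on_span [OF lin _ assms(2)] by blast
  then show ?thesis
    by (simp add: linear_diff [OF lin] linear_scale [OF lin])
qed

text \<open>
  The effect of a triangular change of vectors with diagonal entries \<open>c i\<close>. The entries of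
  \<open>vs\<close> are exchanged for those of \<open>us\<close> from left to right; at the time of the \<open>i\<close>-th exchange the
  list holds \<open>us\<close> before and \<open>vs\<close> after that position, which is why the error may involve both.
\<close>

lemma wedge_triangular:
  fixes us vs :: "(real ^ 'n) list"
  assumes "length vs = length us"
    and "\<And>i. i < length us \<Longrightarrow>
      vs ! i - c i *\<^sub>R us ! i \<in> span (set (take i us) \<union> set (drop (Suc i) vs))"
  shows "wedge vs = (\<Prod>i<length us. c i) *\<^sub>R wedge us"
proof -
  have "wedge vs = (\<Prod>i<m. c i) *\<^sub>R wedge (take m us @ drop m vs)" if "m \<le> length us" for m
    using that
  proof (induction m)
    case (Suc m)
    define ws where "ws = take m us @ drop m vs"
    have m: "m < length us" using Suc.prems by simp
    have len: "length (take m us) = m" using m by simp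
    have vs: "drop m vs = vs ! m # drop (Suc m) vs"
      using m assms(1) by (simp add: Cons_nth_drop_Suc)
    have "ws[m := vs ! m] = ws"
      "ws[m := us ! m] = take (Suc m) us @ drop (Suc m) vs"
      using m by (simp_all add: ws_def vs list_update_append take_Suc_conv_app_nth)
    moreover have "take m ws = take m us" "drop (Suc m) ws = drop (Suc m) vs" "m < length ws"
      using m by (simp_all add: ws_def vs)
    ultimately have "wedge ws = c m *\<^sub>R wedge (take (Suc m) us @ drop (Suc m) vs)"
      using wedge_update_span [of m ws "vs ! m" "c m" "us ! m"] assms(2) [OF m] by simp
    then show ?case
      using Suc.IH m by (simp add: ws_def)
  qed simp
  from this [of "length us"] show ?thesis by (simp add: assms(1))
qed


section \<open>Products of orthogonal vectors\<close>

text \<open>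
  Polarisation of \<open>v v = v \<bullet> v\<close>.
\<close>

lemma cvec_anticommute:
  assumes "orthogonal x y"
  shows "cvec x * cvec y = - (cvec y * cvec x)"
proof -
  have "cvec (x + y) * cvec (x + y) = cvec x * cvec x + cvec y * cvec y"
    using assms unfolding cvec_square
    by (simp add: orthogonal_def inner_add_left inner_add_right inner_commute)
  then show ?thesis
    by (simp add: linear_add [OF linear_cvec] algebra_simps eq_neg_iff_add_eq_0)
qed

lemma cvec_prod_commute:
  assumes "\<And>y. y \<in> set ys \<Longrightarrow> orthogonal x y"
  shows "cvec x * prod_list (map cvec ys) = (- 1) ^ length ys *\<^sub>R (prod_list (map cvec ys) * cvec x)"
  using assms
proof (induction ys)
  case (Cons y ys)
  have "cvec x * (cvec y * prod_list (map cvec ys)) = - (cvec y * (cvec x * prod_list (map cvec ys)))"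
    using cvec_anticommute [of x y] Cons.prems by (simp flip: mult.assoc)
  also have "cvec x * prod_list (map cvec ys) = (- 1) ^ length ys *\<^sub>R (prod_list (map cvec ys) * cvec x)"
    using Cons by simp
  finally show ?case by (simp add: mult.assoc)
qed simp

lemma cvec_mult_prod_omit:
  assumes "\<And>y. y \<in> set ys \<Longrightarrow> orthogonal x y"
  shows "cvec x * prod_list (map cvec (ys @ zs)) =
    (- 1) ^ length ys *\<^sub>R prod_list (map cvec (ys @ x # zs))"
  using cvec_prod_commute [of ys x] assms by (simp flip: mult.assoc)

text \<open>
  Carrying \<open>x\<close> and \<open>y\<close> past \<open>ws\<close> costs the same sign \<open>(- 1) ^ length ws\<close> twice; what remains is
  the single sign from exchanging \<open>x\<close> and \<open>y\<close>.
\<close>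

lemma cvec_prod_swap:
  assumes "orthogonal x y"
    and "\<And>w. w \<in> set ws \<Longrightarrow> orthogonal x w" and "\<And>w. w \<in> set ws \<Longrightarrow> orthogonal y w"
  shows "prod_list (map cvec (y # ws @ [x])) = - prod_list (map cvec (x # ws @ [y]))"
proof -
  let ?W = "prod_list (map cvec ws)"
  have "cvec y * ?W * cvec x = (- 1) ^ length ws *\<^sub>R (?W * (cvec y * cvec x))"
    using cvec_prod_commute [of ws y] assms(3) by (simp add: mult.assoc)
  also have "\<dots> = - ((- 1) ^ length ws *\<^sub>R (?W * cvec x) * cvec y)"
    using cvec_anticommute [OF assms(1)] by (simp add: mult.assoc)
  also have "\<dots> = - (cvec x * ?W * cvec y)"
    using cvec_prod_commute [of ws x] assms(2) by simp
  finally show ?thesis by (simp add: mult.assoc)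
qed

lemma cvec_prod_transpose:
  fixes g :: "nat \<Rightarrow> real ^ 'n"
  assumes orth: "\<And>i j. i < k \<Longrightarrow> j < k \<Longrightarrow> i \<noteq> j \<Longrightarrow> orthogonal (g i) (g j)"
    and "a < b" "b < k"
  shows "prod_list (map (\<lambda>i. cvec (g (Transposition.transpose a b i))) [0..<k]) =
    - prod_list (map (\<lambda>i. cvec (g i)) [0..<k])"
proof -
  let ?h = "\<lambda>i. g (Transposition.transpose a b i)"
  have "[0..<k] = [0..<a] @ [a..<k]" "[a..<k] = a # [Suc a..<b] @ [b..<k]" "[b..<k] = b # [Suc b..<k]"
    using assms(2,3) upt_add_eq_append [of 0 a "k - a"] upt_add_eq_append [of "Suc a" b "k - b"]
    by (simp_all add: upt_conv_Cons)
  then have split: "[0..<k] = [0..<a] @ (a # [Suc a..<b] @ [b]) @ [Suc b..<k]" by simp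
  have "map ?h [0..<a] = map g [0..<a]" "map ?h [Suc a..<b] = map g [Suc a..<b]"
    "map ?h [Suc b..<k] = map g [Suc b..<k]"
    using assms(2) by (auto simp: Transposition.transpose_def)
  then have h: "map ?h [0..<k] =
      map g [0..<a] @ (g b # map g [Suc a..<b] @ [g a]) @ map g [Suc b..<k]"
    unfolding split by simp
  have g: "map g [0..<k] = map g [0..<a] @ (g a # map g [Suc a..<b] @ [g b]) @ map g [Suc b..<k]"
    unfolding split by simp
  have "prod_list (map cvec (g b # map g [Suc a..<b] @ [g a])) =
      - prod_list (map cvec (g a # map g [Suc a..<b] @ [g b]))"
    using assms(2,3) by (intro cvec_prod_swap) (auto intro!: orth)
  then have "prod_list (map cvec (map ?h [0..<k])) = - prod_list (map cvec (map g [0..<k]))"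
    unfolding h g map_append prod_list.append by simp
  then show ?thesis by (simp add: comp_def)
qed

lemma cvec_prod_permutes:
  fixes g :: "nat \<Rightarrow> real ^ 'n"
  assumes "\<sigma> permutes {..<k}"
    and orth: "\<And>i j. i < k \<Longrightarrow> j < k \<Longrightarrow> i \<noteq> j \<Longrightarrow> orthogonal (g i) (g j)"
  shows "prod_list (map (\<lambda>i. cvec (g (\<sigma> i))) [0..<k]) =
    of_int (sign \<sigma>) *\<^sub>R prod_list (map (\<lambda>i. cvec (g i)) [0..<k])"
  using finite_lessThan assms(1)
proof (induction \<sigma> rule: permutes_rev_induct)
  case id
  then show ?case by simp
next
  case (swap a b p)
  note ab = swap.hyps(1-3) and IH = swap.IH and p = swap.hyps(4)
  have orth': "orthogonal (g (p i)) (g (p j))" if "i < k" "j < k" "i \<noteq> j" for i j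
    using that permutes_in_image [OF p] permutes_inj [OF p]
    by (intro orth) (auto dest: injD)
  have flip: "prod_list (map (\<lambda>i. cvec (g (p (Transposition.transpose a b i)))) [0..<k]) =
      - prod_list (map (\<lambda>i. cvec (g (p i))) [0..<k])" if "a < b" "b < k" for a b
    using orth' that by (rule cvec_prod_transpose)
  have "prod_list (map (\<lambda>i. cvec (g (p (Transposition.transpose a b i)))) [0..<k]) =
      - prod_list (map (\<lambda>i. cvec (g (p i))) [0..<k])"
    using ab flip [of a b] flip [of b a]
    by (cases "a < b") (auto simp: transpose_commute [of b a])
  moreover have "permutation p"
    using p permutation_permutes by blast
  then have "sign (p \<circ> Transposition.transpose a b) = - sign p"
    using ab by (simp add: sign_compose permutation_swap_id sign_swap_id)
  ultimately show ?case
    using IH by (simp add: comp_def)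
qed

text \<open>
  Reordering the product by \<open>\<sigma>\<close> gives the sign of \<open>\<sigma>\<close>, which cancels the sign in the
  definition of the wedge: all of the \<open>k!\<close> terms are equal.
\<close>

lemma wedge_orthogonal:
  fixes us :: "(real ^ 'n) list"
  assumes "sorted_wrt orthogonal us"
  shows "wedge us = prod_list (map cvec us)"
proof -
  let ?k = "length us"
  have orth: "orthogonal (us ! i) (us ! j)" if "i < ?k" "j < ?k" "i \<noteq> j" for i j
    using that sorted_wrt_nth_less [OF assms, of i j] sorted_wrt_nth_less [OF assms, of j i]
    by (cases "i < j") (auto simp: orthogonal_commute [of "us ! i"])
  have us: "map (\<lambda>i. cvec (us ! i)) [0..<?k] = map cvec us"
    by (rule nth_equalityI) simp_all
  have "of_int (sign \<sigma>) *\<^sub>R prod_list (map (\<lambda>i. cvec (us ! \<sigma> i)) [0..<?k]) = prod_list (map cvec us)"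
    if "\<sigma> permutes {..<?k}" for \<sigma>
    using cvec_prod_permutes [OF that, of "\<lambda>i. us ! i"] orth
    by (simp add: us sign_idempotent flip: of_int_mult)
  then have "wedge us = (1 / fact ?k) *\<^sub>R (\<Sum>\<sigma> | \<sigma> permutes {..<?k}. prod_list (map cvec us))"
    unfolding wedge_def by simp
  then show ?thesis
    by (simp add: card_permutations [of _ ?k] sum_constant_scaleR del: sum_constant)
qed

lemma cvec_prod_invertible:
  assumes "0 \<notin> set us"
  shows "\<exists>y. prod_list (map cvec us) * y = 1 \<and> y * prod_list (map cvec us) = 1"
  using assms
proof (induction us)
  case (Cons u us)
  then obtain y where y: "prod_list (map cvec us) * y = 1" "y * prod_list (map cvec us) = 1"
    by auto
  define c where "c = cvec u"
  have c: "c * c = (u \<bullet> u) *\<^sub>R 1"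
    by (simp add: c_def cvec_square of_real_def)
  have u: "u \<bullet> u \<noteq> 0" using Cons.prems by simp
  let ?P = "prod_list (map cvec us)" and ?z = "(1 / (u \<bullet> u)) *\<^sub>R (y * c)"
  have "c * ?P * ?z = (1 / (u \<bullet> u)) *\<^sub>R (c * (?P * y) * c)"
    by (simp add: mult.assoc)
  moreover have "?z * (c * ?P) = (1 / (u \<bullet> u)) *\<^sub>R (y * (c * c) * ?P)"
    by (simp add: mult.assoc)
  ultimately have "c * ?P * ?z = 1 \<and> ?z * (c * ?P) = 1"
    using u by (simp add: y c)
  then have "\<exists>z. c * ?P * z = 1 \<and> z * (c * ?P) = 1" by blast
  then show ?case by (simp add: c_def)
qed auto

lemma orthogonal_expansion:
  fixes d :: "'i \<Rightarrow> 'a::euclidean_space"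
  assumes "finite I" and "card I = DIM('a)"
    and nz: "\<And>i. i \<in> I \<Longrightarrow> d i \<noteq> 0"
    and orth: "\<And>i j. i \<in> I \<Longrightarrow> j \<in> I \<Longrightarrow> i \<noteq> j \<Longrightarrow> orthogonal (d i) (d j)"
  shows "(\<Sum>i\<in>I. ((g \<bullet> d i) / (norm (d i))\<^sup>2) *\<^sub>R d i) = g"
proof -
  let ?s = "\<Sum>i\<in>I. ((g \<bullet> d i) / (norm (d i))\<^sup>2) *\<^sub>R d i"
  have inj: "inj_on d I"
    using nz orth by (metis inj_onI orthogonal_self)
  have "independent (d ` I)"
    using nz orth by (intro pairwise_orthogonal_independent) (auto simp: pairwise_def)
  then have span: "span (d ` I) = UNIV"
    using assms(2) card_image [OF inj]
    by (metis UNIV_I card_ge_dim_independent dim_UNIV order_refl subsetI subset_antisym)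
  have "orthogonal (g - ?s) (d j)" if j: "j \<in> I" for j
  proof -
    have "?s \<bullet> d j = (\<Sum>i\<in>I. if i = j then g \<bullet> d j else 0)"
      unfolding inner_sum_left
    proof (rule sum.cong [OF refl])
      fix i assume "i \<in> I"
      then show "(((g \<bullet> d i) / (norm (d i))\<^sup>2) *\<^sub>R d i) \<bullet> d j = (if i = j then g \<bullet> d j else 0)"
        using nz j orth [of i j] by (auto simp: orthogonal_def power2_norm_eq_inner)
    qed
    then show ?thesis
      using assms(1) j by (simp add: orthogonal_def inner_diff_left)
  qed
  then have "orthogonal (g - ?s) (g - ?s)"
    using orthogonal_to_span [of "g - ?s" "d ` I" "g - ?s"] span by auto
  then show ?thesis by (simp add: orthogonal_self)
qed


section \<open>The orthogonal frame of a simplex\<close>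

text \<open>
  With the last vertex as the tip of \<open>a n\<close>, the mean multi-difference treats all indices alike:
  each \<open>f (tip a i) - f (a i)\<close> is the increment of \<open>f\<close> along the leg \<open>tip a i - a i\<close>.
\<close>

definition tip :: "(nat \<Rightarrow> real ^ 'n::finite) \<Rightarrow> nat \<Rightarrow> real ^ 'n" where
  "tip a i = (if i < CARD('n) then mirror a i else a (CARD('n) + 1))"

definition leg :: "(nat \<Rightarrow> real ^ 'n::finite) \<Rightarrow> nat \<Rightarrow> real ^ 'n" where
  "leg a i = tip a i - a i"

lemma mirror_cases:
  fixes a :: "nat \<Rightarrow> real ^ 'n::finite"
  assumes "i \<le> CARD('n)"
  obtains p where "p \<in> affine hull (a ` {i + 1..CARD('n) + 1})" "mirror a i = 2 *\<^sub>R p - a i"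
    "\<And>q. q \<in> affine hull (a ` {i + 1..CARD('n) + 1}) \<Longrightarrow> orthogonal (a i - p) (q - p)"
proof
  let ?S = "affine hull (a ` {i + 1..CARD('n) + 1})"
  have S: "affine ?S" "?S \<noteq> {}" using assms by auto
  show "affine_proj ?S (a i) \<in> ?S" "mirror a i = 2 *\<^sub>R affine_proj ?S (a i) - a i"
    "\<And>q. q \<in> ?S \<Longrightarrow> orthogonal (a i - affine_proj ?S (a i)) (q - affine_proj ?S (a i))"
    using affine_proj_works [OF S] by (auto simp: mirror_def)
qed

text \<open>
  A reflection is an isometry that fixes the points \<open>q\<close> of its mirror.
\<close>

lemma norm_mirror_diff:
  fixes a :: "nat \<Rightarrow> real ^ 'n::finite"
  assumes "i \<le> CARD('n)" and "q \<in> affine hull (a ` {i + 1..CARD('n) + 1})"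
  shows "norm (mirror a i - q) = norm (a i - q)"
proof -
  obtain p where p: "mirror a i = 2 *\<^sub>R p - a i" "orthogonal (a i - p) (q - p)"
    using mirror_cases [OF assms(1), of a] assms(2) by metis
  have "mirror a i - q = - (a i - p) - (q - p)" "a i - q = (a i - p) - (q - p)"
    by (simp_all add: p(1) scaleR_2)
  moreover have "norm (- u - v) = norm (u - v)" if "orthogonal u v" for u v :: "real ^ 'n"
    using that by (simp add: norm_eq orthogonal_def inner_diff_left inner_diff_right inner_commute)
  ultimately show ?thesis using p(2) by metis
qed

lemma tip_in_hull:
  fixes a :: "nat \<Rightarrow> real ^ 'n::finite"
  assumes "i \<le> CARD('n)"
  shows "tip a i \<in> affine hull (a ` {i..CARD('n) + 1})"
proof (cases "i < CARD('n)")
  case True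
  let ?S = "affine hull (a ` {i..CARD('n) + 1})"
  obtain p where p: "p \<in> affine hull (a ` {i + 1..CARD('n) + 1})" "mirror a i = 2 *\<^sub>R p - a i"
    using mirror_cases [OF assms, of a] by metis
  have "p \<in> ?S"
    by (rule subsetD [OF hull_mono p(1)]) auto
  moreover have "a i \<in> ?S" using assms by (intro hull_inc) simp
  ultimately have "2 *\<^sub>R p + (- 1) *\<^sub>R a i \<in> ?S"
    by (intro mem_affine) simp_all
  then show ?thesis using True by (simp add: tip_def p(2))
next
  case False
  then show ?thesis using assms by (auto simp: tip_def intro: hull_inc)
qed

text \<open>
  The vector \<open>leg a i\<close> is a multiple of the perpendicular from \<open>a i\<close> to the later face, and
  both ends of \<open>leg a j\<close> lie in that face.
\<close>

lemma leg_orthogonal: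
  fixes a :: "nat \<Rightarrow> real ^ 'n::finite"
  assumes "i < j" "j \<le> CARD('n)"
  shows "orthogonal (leg a i) (leg a j)"
proof -
  let ?S = "affine hull (a ` {i + 1..CARD('n) + 1})"
  obtain p where p: "mirror a i = 2 *\<^sub>R p - a i" "\<And>q. q \<in> ?S \<Longrightarrow> orthogonal (a i - p) (q - p)"
    using mirror_cases [of i a] assms by (metis less_imp_le order.strict_trans2)
  have "tip a j \<in> ?S"
    by (rule subsetD [OF hull_mono tip_in_hull [OF assms(2)]]) (use assms(1) in auto)
  moreover have "a j \<in> ?S" using assms by (intro hull_inc) simp
  ultimately have "orthogonal (a i - p) ((tip a j - p) - (a j - p))"
    using p(2) by (simp only: orthogonal_clauses)
  moreover have "leg a i = (- 2) *\<^sub>R (a i - p)"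
    using assms by (simp add: leg_def tip_def p(1) scaleR_2 algebra_simps)
  ultimately show ?thesis by (simp add: leg_def orthogonal_clauses)
qed

text \<open>
  The direction space of each face of later vertices is spanned by the later legs. This is the
  triangularity behind \<open>wedge_legs\<close>: passing from \<open>Suc j\<close> to \<open>j\<close> adds the vertex \<open>a j\<close>,
  which differs from its projection \<open>r\<close> to the previous face by half of \<open>leg a j\<close>.
\<close>

lemma hull_diff_in_span_legs:
  fixes a :: "nat \<Rightarrow> real ^ 'n::finite"
  assumes "j \<le> CARD('n) + 1"
    and "p \<in> affine hull (a ` {j..CARD('n) + 1})" and "q \<in> affine hull (a ` {j..CARD('n) + 1})"
  shows "p - q \<in> span (leg a ` {j..CARD('n)})"
  using assms
proof (induction j arbitrary: p q rule: inc_induct)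
  case base
  then show ?case by simp
next
  case (step j)
  let ?S = "affine hull (a ` {Suc j..CARD('n) + 1})" and ?V = "span (leg a ` {j..CARD('n)})"
  let ?o = "a (CARD('n) + 1)"
  have o: "?o \<in> ?S" using step.hyps by (intro hull_inc) simp
  have later: "x - ?o \<in> ?V" if "x \<in> ?S" for x
    by (rule subsetD [OF span_mono step.IH [OF that o]]) auto
  have leg: "leg a j \<in> ?V" using step.hyps by (intro span_base) simp
  have first: "a j - ?o \<in> ?V"
  proof (cases "j < CARD('n)")
    case True
    then obtain r where r: "r \<in> ?S" "mirror a j = 2 *\<^sub>R r - a j"
      using mirror_cases [of j a] by (metis less_imp_le Suc_eq_plus1)
    have "leg a j = 2 *\<^sub>R (r - a j)"
      using True by (simp add: leg_def tip_def r(2) scaleR_2 algebra_simps)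
    then have "a j - ?o = (r - ?o) - (1 / 2) *\<^sub>R leg a j"
      by simp
    then show ?thesis using later [OF r(1)] leg by (simp only: span_diff span_scale)
  next
    case False
    then have "a j - ?o = - leg a j" by (simp add: leg_def tip_def)
    then show ?thesis using leg by (simp only: span_neg)
  qed
  have "a k - ?o \<in> ?V" if "k \<in> {j..CARD('n) + 1}" for k
  proof (cases "k = j")
    case False
    then have "a k \<in> ?S" using that by (intro hull_inc) auto
    then show ?thesis by (rule later)
  qed (use first in simp)
  then have "a ` {j..CARD('n) + 1} \<subseteq> {x. x - ?o \<in> ?V}" by auto
  moreover have "affine {x. x - ?o \<in> ?V}"
    unfolding affine_def
  proof (intro ballI allI impI CollectI)
    fix x y u v assume *: "x \<in> {x. x - ?o \<in> ?V}" "y \<in> {x. x - ?o \<in> ?V}" "u + v = (1::real)"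
    have "u *\<^sub>R x + v *\<^sub>R y - ?o = u *\<^sub>R x + v *\<^sub>R y - (u + v) *\<^sub>R ?o"
      by (simp add: *(3))
    also have "\<dots> = u *\<^sub>R (x - ?o) + v *\<^sub>R (y - ?o)"
      by (simp add: algebra_simps)
    finally show "u *\<^sub>R x + v *\<^sub>R y - ?o \<in> ?V"
      using * by (simp add: span_add span_scale)
  qed
  ultimately have "affine hull (a ` {j..CARD('n) + 1}) \<subseteq> {x. x - ?o \<in> ?V}"
    by (rule hull_minimal)
  then have "p - ?o \<in> ?V" "q - ?o \<in> ?V" using step.prems by blast+
  then have "(p - ?o) - (q - ?o) \<in> ?V" by (rule span_diff)
  then show ?case by simp
qed

lemma wedge_legs:
  fixes a :: "nat \<Rightarrow> real ^ 'n::finite"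
  shows "wedge (map (leg a) [1..<CARD('n) + 1]) = 2 ^ (CARD('n) - 1) *\<^sub>R simplex_Delta a"
proof -
  let ?n = "CARD('n)"
  let ?us = "map (\<lambda>i. a i - a 1) [2..<?n + 2]" and ?vs = "map (leg a) [1..<?n + 1]"
  define c :: "nat \<Rightarrow> real" where "c k = (if k < ?n - 1 then 2 else 1)" for k
  have us: "?us ! k = a (k + 2) - a 1" and vs: "?vs ! k = leg a (k + 1)" if "k < ?n" for k
    using that by (auto simp del: upt_Suc simp: add.commute)
  have "?vs ! k - c k *\<^sub>R ?us ! k \<in> span (set (take k ?us) \<union> set (drop (Suc k) ?vs))" (is "_ \<in> ?V")
    if "k < length ?us" for k
  proof -
    have k: "k < ?n" using that by (simp del: upt_Suc)
    \<comment> \<open>This is the previous entry of \<open>?us\<close>, or zero at the first position.\<close>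
    have earlier: "a (k + 1) - a 1 \<in> ?V"
    proof (cases k)
      case 0
      then show ?thesis by (simp add: span_zero)
    next
      case (Suc l)
      then have "a (k + 1) - a 1 = take k ?us ! l" "l < length (take k ?us)"
        using us [of l] k by (simp_all del: upt_Suc)
      then show ?thesis by (metis UnI1 nth_mem span_base)
    qed
    show ?thesis
    proof (cases "k < ?n - 1")
      case True
      then have k1: "k + 1 \<le> ?n" "k + 1 < ?n" "k + 2 \<le> ?n + 1" by simp_all
      obtain p where p: "p \<in> affine hull (a ` {k + 2..?n + 1})" "mirror a (k + 1) = 2 *\<^sub>R p - a (k + 1)"
        using mirror_cases [OF k1(1), of a] by (metis add.assoc one_add_one)
      have "a (k + 2) \<in> affine hull (a ` {k + 2..?n + 1})"
        using k1 by (intro hull_inc) simp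
      then have "p - a (k + 2) \<in> span (leg a ` {k + 2..?n})"
        by (rule hull_diff_in_span_legs [OF k1(3) p(1)])
      moreover have "set (drop (Suc k) ?vs) = leg a ` {k + 2..?n}"
        by (auto simp: drop_map simp del: upt_Suc)
      then have "span (leg a ` {k + 2..?n}) \<subseteq> ?V"
        by (intro span_mono) simp
      ultimately have "p - a (k + 2) \<in> ?V" by blast
      \<comment> \<open>With \<open>p\<close> the foot of the perpendicular, the first difference below is parallel to a
        face of later vertices and the second one is an earlier edge vector.\<close>
      moreover have "?vs ! k - c k *\<^sub>R ?us ! k = 2 *\<^sub>R (p - a (k + 2)) - 2 *\<^sub>R (a (k + 1) - a 1)"
        unfolding us [OF k] vs [OF k] leg_def tip_def
        using True k1 p(2) by (simp add: c_def algebra_simps scaleR_2)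
      ultimately show ?thesis using earlier by (simp only: span_diff span_scale)
    next
      case False
      then have "k + 1 = ?n" using k by simp
      then have "?vs ! k - c k *\<^sub>R ?us ! k = - (a (k + 1) - a 1)"
        unfolding us [OF k] vs [OF k] leg_def tip_def by (auto simp: c_def)
      then show ?thesis using earlier by (simp only: span_neg)
    qed
  qed
  then have "wedge ?vs = (\<Prod>k<length ?us. c k) *\<^sub>R wedge ?us"
    by (intro wedge_triangular) (simp_all del: upt_Suc)
  also have "(\<Prod>k<length ?us. c k) = 2 ^ (?n - 1)"
  proof -
    obtain m where m: "?n = Suc m" using zero_less_card_finite [where 'a = 'n] gr0_implies_Suc by blast
    have "(\<Prod>k<Suc m. c k) = 2 ^ m" by (simp add: c_def m)
    then show ?thesis by (simp add: m del: prod.lessThan_Suc upt_Suc)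
  qed
  finally show ?thesis by (simp add: simplex_Delta_def)
qed

lemma wedge_legs_eq_prod:
  fixes a :: "nat \<Rightarrow> real ^ 'n::finite"
  assumes "sorted_wrt (<) js" "set js \<subseteq> {..CARD('n)}"
  shows "wedge (map (leg a) js) = prod_list (map cvec (map (leg a) js))"
  using assms leg_orthogonal [where a = a]
  by (intro wedge_orthogonal)
    (auto simp: sorted_wrt_map intro: sorted_wrt_mono_rel [where P = "(<)"])

definition legs_omit :: "(nat \<Rightarrow> real ^ 'n::finite) \<Rightarrow> nat \<Rightarrow> 'n clifford" where
  "legs_omit a i = wedge (map (leg a) (filter (\<lambda>j. j \<noteq> i) [1..<CARD('n) + 1]))"

lemma mean_multi_difference_legs:
  fixes a :: "nat \<Rightarrow> real ^ 'n::finite"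
  shows "mean_multi_difference f a = (1 / 2 ^ (CARD('n) - 1)) *\<^sub>R
    (\<Sum>i = 1..CARD('n). ((- 1) ^ (i + 1) * (f (tip a i) - f (a i))) *\<^sub>R legs_omit a i)"
proof -
  let ?n = "CARD('n)"
  obtain m where m: "?n = Suc m" using zero_less_card_finite [where 'a = 'n] gr0_implies_Suc by blast
  have upt: "[1..<?n + 1] = [1..<?n] @ [?n]" by (simp add: m)
  have leg_mirror: "leg a j = mirror a j - a j" if "j < ?n" for j
    using that by (simp add: leg_def tip_def)
  have "mirror_Delta_omit a i = legs_omit a i" if "i < ?n" for i
    using that unfolding mirror_Delta_omit_def legs_omit_def upt
    by (intro arg_cong [where f = wedge]) (auto simp: leg_mirror leg_def [of a ?n] tip_def)
  moreover have "mirror_Delta a = legs_omit a ?n"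
    unfolding mirror_Delta_def legs_omit_def upt
    by (intro arg_cong [where f = wedge]) (auto simp: leg_mirror filter_id_conv)
  moreover have "(\<Sum>i = 1..?n. F i) = (\<Sum>i = 1..?n - 1. F i) + F ?n" for F :: "nat \<Rightarrow> 'n clifford"
    by (simp add: m)
  ultimately show ?thesis
    unfolding mean_multi_difference_def by (simp add: tip_def m)
qed

text \<open>
  The leg \<open>leg a i\<close> travels past the \<open>i - 1\<close> earlier legs to its own place.
\<close>

lemma leg_mult_legs_omit:
  fixes a :: "nat \<Rightarrow> real ^ 'n::finite"
  assumes "i \<in> {1..CARD('n)}"
  shows "cvec (leg a i) * legs_omit a i =
    (- 1) ^ (i + 1) *\<^sub>R prod_list (map cvec (map (leg a) [1..<CARD('n) + 1]))"
proof -
  let ?n = "CARD('n)"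
  have "[1..<?n + 1] = [1..<i] @ [i..<?n + 1]" "[i..<?n + 1] = i # [i + 1..<?n + 1]"
    using assms upt_add_eq_append [of 1 i "?n + 1 - i"] by (auto simp: upt_conv_Cons simp del: upt_Suc)
  then have upt: "[1..<?n + 1] = [1..<i] @ i # [i + 1..<?n + 1]" by simp
  have "filter (\<lambda>j. j \<noteq> i) [1..<?n + 1] = [1..<i] @ [i + 1..<?n + 1]"
    unfolding upt by (simp add: filter_id_conv del: upt_Suc)
  then have omit: "legs_omit a i = prod_list (map cvec (map (leg a) [1..<i] @ map (leg a) [i + 1..<?n + 1]))"
    unfolding legs_omit_def map_append [symmetric]
    using assms by (simp only:) (rule wedge_legs_eq_prod, auto simp: sorted_wrt_append simp del: upt_Suc)
  have "cvec (leg a i) * legs_omit a i = (- 1) ^ length (map (leg a) [1..<i]) *\<^sub>R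
      prod_list (map cvec (map (leg a) [1..<i] @ leg a i # map (leg a) [i + 1..<?n + 1]))"
    unfolding omit using assms leg_orthogonal [of _ i a]
    by (intro cvec_mult_prod_omit) (auto simp: orthogonal_commute [of "leg a i"])
  moreover have "(- 1 :: real) ^ (i + 1) = (- 1) ^ (i - 1)"
    using assms by (cases i) simp_all
  ultimately show ?thesis
    unfolding upt by simp
qed

text \<open>
  A vanishing leg would make the product of the legs, a multiple of \<open>simplex_Delta a\<close>, vanish.
\<close>

lemma legs_nonzero:
  fixes a :: "nat \<Rightarrow> real ^ 'n::finite"
  assumes "simplex_Delta a \<noteq> 0" "i \<in> {1..CARD('n)}"
  shows "leg a i \<noteq> 0"
proof
  assume "leg a i = 0"
  then have "0 \<in> set (map cvec (map (leg a) [1..<CARD('n) + 1]))"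
    using assms(2) linear_0 [OF linear_cvec] by (force simp: image_iff simp del: upt_Suc)
  then obtain xs ys where "map cvec (map (leg a) [1..<CARD('n) + 1]) = xs @ 0 # ys"
    using split_list by metis
  then have "prod_list (map cvec (map (leg a) [1..<CARD('n) + 1])) = 0"
    by (simp only:) simp
  then have "wedge (map (leg a) [1..<CARD('n) + 1]) = 0"
    using wedge_legs_eq_prod [of "[1..<CARD('n) + 1]" a] by (simp add: subset_iff del: upt_Suc)
  with assms(1) show False by (simp only: wedge_legs) simp
qed

text \<open>
  The quotient is a vector because the omitted products are vectors times the
  common factor \<open>D\<close>, which is a multiple of \<open>simplex_Delta a\<close>.
\<close>

lemma mean_multi_difference_quotient:
  fixes a :: "nat \<Rightarrow> real ^ 'n::finite"
  assumes "simplex_Delta a \<noteq> 0"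
  shows "mean_multi_difference f a * clifford_inverse (simplex_Delta a) =
    cvec (\<Sum>i = 1..CARD('n). ((f (tip a i) - f (a i)) / (norm (leg a i))\<^sup>2) *\<^sub>R leg a i)"
proof -
  let ?n = "CARD('n)"
  define D where "D = prod_list (map cvec (map (leg a) [1..<?n + 1]))"
  have "D = 2 ^ (?n - 1) *\<^sub>R simplex_Delta a"
    using wedge_legs [of a] wedge_legs_eq_prod [of "[1..<?n + 1]" a]
    by (simp add: D_def subset_iff del: upt_Suc)
  then have Delta: "simplex_Delta a = (1 / 2 ^ (?n - 1)) *\<^sub>R D"
    by simp
  have "0 \<notin> set (map (leg a) [1..<?n + 1])"
    using legs_nonzero [OF assms] by (force simp del: upt_Suc)
  then obtain y where y: "D * y = 1" "y * D = 1"
    using cvec_prod_invertible unfolding D_def by blast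
  have inv: "clifford_inverse (simplex_Delta a) = 2 ^ (?n - 1) *\<^sub>R y"
    unfolding Delta by (rule clifford_inverse_eqI) (simp_all add: y)
  have omit: "legs_omit a i = ((- 1) ^ (i + 1) / (norm (leg a i))\<^sup>2) *\<^sub>R (cvec (leg a i) * D)"
    if "i \<in> {1..?n}" for i
  proof -
    \<comment> \<open>Multiplying \<open>leg_mult_legs_omit\<close> by the same leg once more turns the leg on the left into a scalar.\<close>
    have "(norm (leg a i))\<^sup>2 *\<^sub>R legs_omit a i = cvec (leg a i) * (cvec (leg a i) * legs_omit a i)"
      using cvec_square [of "leg a i"]
      by (simp add: power2_norm_eq_inner of_real_def flip: mult.assoc)
    also have "\<dots> = (- 1) ^ (i + 1) *\<^sub>R (cvec (leg a i) * D)"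
      by (simp add: leg_mult_legs_omit [OF that] D_def del: upt_Suc)
    finally have "(1 / (norm (leg a i))\<^sup>2) *\<^sub>R ((norm (leg a i))\<^sup>2 *\<^sub>R legs_omit a i) =
        (1 / (norm (leg a i))\<^sup>2) *\<^sub>R ((- 1) ^ (i + 1) *\<^sub>R (cvec (leg a i) * D))" by simp
    then show ?thesis using legs_nonzero [OF assms that] by simp
  qed
  have "mean_multi_difference f a = (1 / 2 ^ (?n - 1)) *\<^sub>R
      (\<Sum>i = 1..?n. ((f (tip a i) - f (a i)) / (norm (leg a i))\<^sup>2) *\<^sub>R (cvec (leg a i) * D))"
    unfolding mean_multi_difference_legs
  proof (intro arg_cong [where f = "(*\<^sub>R) _"] sum.cong refl)
    fix i assume "i \<in> {1..?n}"
    have "(- 1 :: real) ^ (i + 1) * (- 1) ^ (i + 1) = 1"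
      by (simp flip: power_mult_distrib)
    then show "((- 1) ^ (i + 1) * (f (tip a i) - f (a i))) *\<^sub>R legs_omit a i =
        ((f (tip a i) - f (a i)) / (norm (leg a i))\<^sup>2) *\<^sub>R (cvec (leg a i) * D)"
      by (simp add: omit [OF \<open>i \<in> {1..?n}\<close>] mult_ac)
  qed
  also have "\<dots> = (1 / 2 ^ (?n - 1)) *\<^sub>R
      (cvec (\<Sum>i = 1..?n. ((f (tip a i) - f (a i)) / (norm (leg a i))\<^sup>2) *\<^sub>R leg a i) * D)"
    by (simp add: linear_sum [OF linear_cvec] linear_scale [OF linear_cvec] sum_distrib_right)
  finally show ?thesis by (simp add: inv mult.assoc y)
qed


section \<open>The limit\<close>

text \<open>
  All mirrors contain the last vertex, so a mirror image is as far from it as the original point.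
\<close>

lemma tip_near:
  fixes a :: "nat \<Rightarrow> real ^ 'n::finite"
  assumes "\<And>i. i \<in> {1..CARD('n) + 1} \<Longrightarrow> norm (a i - x) < \<delta>" and "i \<in> {1..CARD('n)}"
  shows "norm (tip a i - x) < 3 * \<delta>"
proof -
  let ?o = "a (CARD('n) + 1)"
  have i: "norm (a i - x) < \<delta>" and o: "norm (?o - x) < \<delta>"
    using assms by auto
  have "norm (tip a i - ?o) \<le> norm (a i - ?o)"
  proof (cases "i < CARD('n)")
    case True
    then show ?thesis
      using norm_mirror_diff [of i ?o a] by (simp add: tip_def hull_inc)
  qed (simp add: tip_def)
  moreover have "norm (a i - ?o) \<le> norm (a i - x) + norm (?o - x)"
    using norm_triangle_ineq4 [of "a i - x" "?o - x"] by simp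
  moreover have "norm (tip a i - x) \<le> norm (tip a i - ?o) + norm (?o - x)"
    using norm_triangle_ineq [of "tip a i - ?o" "?o - x"] by simp
  ultimately show ?thesis using i o by linarith
qed

text \<open>
  Subtracting the expansion of \<open>g\<close> in the basis \<open>d\<close> leaves coefficients of size at most
  \<open>\<epsilon> / norm (d i)\<close>; the length of \<open>d i\<close> cancels, so the bound does not depend on the basis.
\<close>

lemma orthogonal_quotients_near:
  fixes d :: "'i \<Rightarrow> 'a::euclidean_space" and \<epsilon> :: real
  assumes "finite I" and "card I = DIM('a)"
    and nz: "\<And>i. i \<in> I \<Longrightarrow> d i \<noteq> 0"
    and orth: "\<And>i j. i \<in> I \<Longrightarrow> j \<in> I \<Longrightarrow> i \<noteq> j \<Longrightarrow> orthogonal (d i) (d j)"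
    and approx: "\<And>i. i \<in> I \<Longrightarrow> \<bar>\<phi> i - g \<bullet> d i\<bar> \<le> \<epsilon> * norm (d i)"
  shows "norm ((\<Sum>i\<in>I. (\<phi> i / (norm (d i))\<^sup>2) *\<^sub>R d i) - g) \<le> DIM('a) * \<epsilon>"
proof -
  have "(\<Sum>i\<in>I. (\<phi> i / (norm (d i))\<^sup>2) *\<^sub>R d i) - g =
      (\<Sum>i\<in>I. (\<phi> i / (norm (d i))\<^sup>2) *\<^sub>R d i) - (\<Sum>i\<in>I. ((g \<bullet> d i) / (norm (d i))\<^sup>2) *\<^sub>R d i)"
    using orthogonal_expansion [where g = g, OF assms(1-4)] by simp
  also have "\<dots> = (\<Sum>i\<in>I. ((\<phi> i - g \<bullet> d i) / (norm (d i))\<^sup>2) *\<^sub>R d i)"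
    by (simp add: diff_divide_distrib scaleR_diff_left sum_subtractf)
  also have "norm \<dots> \<le> (\<Sum>i\<in>I. \<epsilon>)"
  proof (rule sum_norm_le)
    fix i assume i: "i \<in> I"
    have "norm (((\<phi> i - g \<bullet> d i) / (norm (d i))\<^sup>2) *\<^sub>R d i) = \<bar>\<phi> i - g \<bullet> d i\<bar> / norm (d i)"
      using nz [OF i] by (simp add: power2_eq_square)
    also have "\<dots> \<le> \<epsilon>"
      using approx [OF i] nz [OF i] by (simp add: divide_le_eq)
    finally show "norm (((\<phi> i - g \<bullet> d i) / (norm (d i))\<^sup>2) *\<^sub>R d i) \<le> \<epsilon>" .
  qed
  finally show ?thesis by (simp add: assms(2))
qed

theorem theorem3:
  fixes f :: "real ^ 'n \<Rightarrow> real"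
    and \<Omega> :: "(real ^ 'n) set"
    and x\<^sub>0 :: "real ^ 'n"
  assumes "CARD('n) > 3"
    and "x\<^sub>0 \<in> interior \<Omega>"
    and "strongly_differentiable f \<Omega> x\<^sub>0"
  shows "((\<lambda>a. mean_multi_difference f a * clifford_inverse (simplex_Delta a)) \<longlongrightarrow>
            cvec (gradient f x\<^sub>0))
         (at (\<lambda>i\<in>{1..CARD('n) + 1}. x\<^sub>0) within
            {a \<in> {1..CARD('n) + 1} \<rightarrow>\<^sub>E \<Omega>.
               simplex_Delta a \<noteq> 0 \<and> (\<forall>i\<in>{1..CARD('n) - 1}. mirror a i \<in> \<Omega>)})"
proof -
  let ?n = "CARD('n)"
  let ?c = "\<lambda>i\<in>{1..?n + 1}. x\<^sub>0"
  let ?T = "{a \<in> {1..?n + 1} \<rightarrow>\<^sub>E \<Omega>. simplex_Delta a \<noteq> 0 \<and> (\<forall>i\<in>{1..?n - 1}. mirror a i \<in> \<Omega>)}"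
  define G where "G a = (\<Sum>i = 1..?n. ((f (tip a i) - f (a i)) / (norm (leg a i))\<^sup>2) *\<^sub>R leg a i)"
    for a :: "nat \<Rightarrow> real ^ 'n"
  obtain g where g: "has_strong_gradient f \<Omega> x\<^sub>0 g"
    using assms(3) by (auto simp: strongly_differentiable_def)
  have grad: "gradient f x\<^sub>0 = g"
    using has_strong_gradient_imp_gradient(2) [OF assms(2) g] .
  have "(G \<longlongrightarrow> g) (at ?c within ?T)"
  proof (rule tendstoI)
    fix e :: real
    assume "e > 0"
    \<comment> \<open>The factor 2 makes the final bound \<open>?n * \<epsilon>\<close> strictly less than \<open>e\<close>.\<close>
    define \<epsilon> where "\<epsilon> = e / (2 * ?n)"
    have \<epsilon>: "\<epsilon> > 0" "?n * \<epsilon> < e" using \<open>e > 0\<close> by (simp_all add: \<epsilon>_def)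
    obtain \<delta> where \<delta>: "\<delta> > 0" "\<And>u v. u \<in> \<Omega> \<Longrightarrow> v \<in> \<Omega> \<Longrightarrow> u \<noteq> v \<Longrightarrow>
        norm (u - x\<^sub>0) < \<delta> \<Longrightarrow> norm (v - x\<^sub>0) < \<delta> \<Longrightarrow> \<bar>f u - f v - g \<bullet> (u - v)\<bar> < \<epsilon> * norm (u - v)"
      using g \<epsilon>(1) unfolding has_strong_gradient_def by meson
    \<comment> \<open>Vertices are kept within \<open>\<delta> / 3\<close>, so that by \<open>tip_near\<close> their mirror images stay within \<open>\<delta>\<close>.\<close>
    have "((\<lambda>a. a i) \<longlongrightarrow> x\<^sub>0) (at ?c within ?T)" if "i \<in> {1..?n + 1}" for i
    proof -
      have "((\<lambda>a. a i) \<longlongrightarrow> ?c i) (at ?c within ?T)"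
        by (rule tendsto_within_subset [OF _ subset_UNIV])
          (rule continuous_on_product_coordinates [unfolded continuous_on_def, rule_format, OF UNIV_I])
      then show ?thesis using that by simp
    qed
    then have "\<forall>i\<in>{1..?n + 1}. \<forall>\<^sub>F a in at ?c within ?T. dist (a i) x\<^sub>0 < \<delta> / 3"
      using \<delta>(1) by (intro ballI tendstoD) auto
    then have "\<forall>\<^sub>F a in at ?c within ?T. \<forall>i\<in>{1..?n + 1}. norm (a i - x\<^sub>0) < \<delta> / 3"
      by (simp add: eventually_ball_finite_distrib dist_norm)
    moreover have "\<forall>\<^sub>F a in at ?c within ?T. a \<in> ?T"
      by (simp add: eventually_at_filter)
    ultimately show "\<forall>\<^sub>F a in at ?c within ?T. dist (G a) g < e"
    proof eventually_elim
      case (elim a)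
      have approx: "\<bar>(f (tip a i) - f (a i)) - g \<bullet> leg a i\<bar> \<le> \<epsilon> * norm (leg a i)"
        if i: "i \<in> {1..?n}" for i
      proof -
        have "norm (tip a i - x\<^sub>0) < \<delta>"
          using tip_near [of a x\<^sub>0 "\<delta> / 3" i] elim(1) i by simp
        moreover have "norm (a i - x\<^sub>0) < \<delta>"
          using bspec [OF elim(1), of i] i \<delta>(1) by simp
        moreover have "tip a i \<in> \<Omega>" "a i \<in> \<Omega>"
          using elim(2) i by (auto simp: tip_def)
        moreover have "tip a i \<noteq> a i"
          using legs_nonzero [of a i] elim(2) i by (simp add: leg_def)
        ultimately show ?thesis
          using \<delta>(2) by (force simp: leg_def)
      qed
      have "norm (G a - g) \<le> DIM(real ^ 'n) * \<epsilon>"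
        unfolding G_def
      proof (rule orthogonal_quotients_near [OF _ _ _ _ approx])
        show "leg a i \<noteq> 0" if "i \<in> {1..?n}" for i
          using legs_nonzero [of a i] elim(2) that by simp
        show "orthogonal (leg a i) (leg a j)" if "i \<in> {1..?n}" "j \<in> {1..?n}" "i \<noteq> j" for i j
          using leg_orthogonal [of i j a] leg_orthogonal [of j i a] that
          by (cases "i < j") (auto simp: orthogonal_commute [of "leg a i"])
      qed simp_all
      then show ?case using \<epsilon>(2) by (simp add: dist_norm)
    qed
  qed
  moreover have "bounded_linear (cvec :: real ^ 'n \<Rightarrow> _)"
    using linear_cvec by (simp add: linear_linear)
  ultimately have "((\<lambda>a. cvec (G a)) \<longlongrightarrow> cvec g) (at ?c within ?T)"
    by (rule bounded_linear.tendsto [rotated])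
  moreover have "\<forall>\<^sub>F a in at ?c within ?T.
      cvec (G a) = mean_multi_difference f a * clifford_inverse (simplex_Delta a)"
    by (simp add: eventually_at_filter G_def mean_multi_difference_quotient)
  ultimately show ?thesis
    unfolding grad by (rule Lim_transform_eventually)
qed

end
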